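(* Let $\mathscr{H}$ be a complex Hilbert space and let $A\in\mathbb{B}(\mathscr{H})$. Then \begin{align*} \frac{1}{4}\|A^*A+AA^*\| &\leq\frac{1}{4}\left[\max\left\{\|\Re(A)+\Im(A)\|^2,\ \|\Re(A)-\Im(A)\|^2\right\}+\|\Re(A)+\Im(A)\|\,\|\Re(A)-\Im(A)\|\right]\\ &\leq w^2(A). \end{align*}
   Context: $\mathbb{B}(\mathscr{H})$ is the algebra of all bounded linear operators on the complex Hilbert space $\mathscr{H}$, and $\|\cdot\|$ is the operator norm. $\Re(A)=\frac{1}{2}(A+A^* )$ and $\Im(A)=\frac{1}{2\mathrm{i}}(A-A^* )$ (both are self-adjoint operators). The numerical radius is $w(A)=\sup\{|\langle Ax,x\rangle|: x\in\mathscr{H},\ \|x\|=1\}$, and $w^2(A)$ means $(w(A))^2$. *)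

theory Defs
  imports "HOL-Analysis.Analysis"
begin

section \<open>Complex Hilbert spaces\<close>

text \<open>
  The metric, topology and real scalar multiplication come from
  \<^class>\<open>real_normed_vector\<close>; the axioms \<open>scaleC_of_real\<close> and \<open>norm_eq_sqrt_cinner\<close>
  tie them to the complex structure. The inner product is linear in its first and
  conjugate-linear in its second argument.
\<close>

class complex_inner = real_normed_vector +
  fixes scaleC :: "complex \<Rightarrow> 'a \<Rightarrow> 'a"  (infixr \<open>*\<^sub>C\<close> 75)
    and cinner :: "'a \<Rightarrow> 'a \<Rightarrow> complex"
  assumes scaleC_add_right: "a *\<^sub>C (x + y) = a *\<^sub>C x + a *\<^sub>C y"
    and scaleC_add_left: "(a + b) *\<^sub>C x = a *\<^sub>C x + b *\<^sub>C x"
    and scaleC_scaleC: "a *\<^sub>C b *\<^sub>C x = (a * b) *\<^sub>C x"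
    and scaleC_one: "1 *\<^sub>C x = x"
    and scaleC_of_real: "complex_of_real r *\<^sub>C x = r *\<^sub>R x"
    and cinner_commute: "cinner x y = cnj (cinner y x)"
    and cinner_add_left: "cinner (x + y) z = cinner x z + cinner y z"
    and cinner_scaleC_left: "cinner (a *\<^sub>C x) y = a * cinner x y"
    and cinner_ge_zero: "0 \<le> Re (cinner x x)"
    and cinner_eq_zero_iff: "cinner x x = 0 \<longleftrightarrow> x = 0"
    and norm_eq_sqrt_cinner: "norm x = sqrt (Re (cinner x x))"

class chilbert_space = complex_inner + complete_space

instantiation complex :: chilbert_space
begin

definition scaleC_complex :: "complex \<Rightarrow> complex \<Rightarrow> complex" where
  "scaleC_complex a x = a * x"

definition cinner_complex :: "complex \<Rightarrow> complex \<Rightarrow> complex" where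
  "cinner_complex x y = x * cnj y"

instance
proof
  fix x :: complex
  show "norm x = sqrt (Re (cinner x x))"
    by (simp add: cinner_complex_def cmod_def power2_eq_square)
qed (auto simp: scaleC_complex_def cinner_complex_def algebra_simps scaleR_conv_of_real)

end


section \<open>Bounded operators\<close>

locale bounded_clinear = bounded_linear f
  for f :: "'a::complex_inner \<Rightarrow> 'b::complex_inner" +
  assumes scaleC: "f (a *\<^sub>C x) = a *\<^sub>C f x"

text \<open>
  On a Hilbert space a bounded operator has exactly one adjoint, by the Riesz
  representation theorem. The description is meaningful only in that case.
\<close>

definition cadjoint :: "('a::complex_inner \<Rightarrow> 'b::complex_inner) \<Rightarrow> 'b \<Rightarrow> 'a" where
  "cadjoint A = (THE B. \<forall>x y. cinner (A x) y = cinner x (B y))"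

definition Re_op :: "('a::complex_inner \<Rightarrow> 'a) \<Rightarrow> 'a \<Rightarrow> 'a" where
  "Re_op A = (\<lambda>x. (1 / 2) *\<^sub>C (A x + cadjoint A x))"

definition Im_op :: "('a::complex_inner \<Rightarrow> 'a) \<Rightarrow> 'a \<Rightarrow> 'a" where
  "Im_op A = (\<lambda>x. (1 / (2 * \<i>)) *\<^sub>C (A x - cadjoint A x))"

text \<open>
  The real supremum below is that of a nonempty bounded set whenever \<open>A\<close> is bounded and
  the space is not \<open>{0}\<close>. On the zero space the set is empty and \<^const>\<open>Sup\<close> is an
  unspecified real number.
\<close>

definition numerical_radius :: "('a::complex_inner \<Rightarrow> 'a) \<Rightarrow> real" where
  "numerical_radius A = (SUP x\<in>{x. norm x = 1}. cmod (cinner (A x) x))"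

end

theory Submission
  imports Defs
begin

text \<open>
  Write \<open>S = \<Re>(A) + \<Im>(A)\<close> and \<open>D = \<Re>(A) - \<Im>(A)\<close>, two self-adjoint operators.

  Two applications of the parallelogram law give
  \<open>\<parallel>S x\<parallel>\<^sup>2 + \<parallel>D x\<parallel>\<^sup>2 = \<parallel>A x\<parallel>\<^sup>2 + \<parallel>A\<^sup>* x\<parallel>\<^sup>2\<close>, and the right-hand side is the quadratic form of
  the self-adjoint operator \<open>A\<^sup>*A + AA\<^sup>*\<close>. The norm of a self-adjoint operator is controlled by
  its quadratic form, so \<open>\<parallel>A\<^sup>*A + AA\<^sup>*\<parallel> \<le> \<parallel>S\<parallel>\<^sup>2 + \<parallel>D\<parallel>\<^sup>2\<close>. The smaller of \<open>\<parallel>S\<parallel>\<^sup>2\<close> and \<open>\<parallel>D\<parallel>\<^sup>2\<close> is at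
  most \<open>\<parallel>S\<parallel> \<parallel>D\<parallel>\<close>, which is the first inequality.

  For the second, \<open>\<langle>A x, x\<rangle>\<close> has real part \<open>\<langle>\<Re>(A) x, x\<rangle>\<close> and imaginary part \<open>\<langle>\<Im>(A) x, x\<rangle>\<close>, and
  the sum or difference of the two parts of a complex number \<open>z\<close> is at most \<open>\<surd>2 \<bar>z\<bar>\<close> in modulus.
  Hence the quadratic forms of \<open>S\<close> and \<open>D\<close>, and with them \<open>\<parallel>S\<parallel>\<close> and \<open>\<parallel>D\<parallel>\<close>, are bounded by
  \<open>\<surd>2 w(A)\<close>. The middle term is at most \<open>1/2 max (\<parallel>S\<parallel>\<^sup>2) (\<parallel>D\<parallel>\<^sup>2)\<close>, so at most \<open>w(A)\<^sup>2\<close>.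

  The adjoint is defined by a description, so all of this rests on its existence, which is
  derived from the Riesz representation theorem. Most arguments use only the real inner product
  \<open>Re \<langle>x, y\<rangle>\<close>, which already determines the norm.
\<close>

section \<open>The inner product\<close>

lemma cinner_scaleR_left: "cinner (r *\<^sub>R x) y = complex_of_real r * cinner x y"
  by (metis cinner_scaleC_left scaleC_of_real)

lemma cinner_minus_left: "cinner (- x) y = - cinner x y"
  using cinner_scaleR_left[of "-1" x y] by simp

lemma cinner_diff_left: "cinner (x - y) z = cinner x z - cinner y z"
  using cinner_add_left[of x "- y" z] by (simp add: cinner_minus_left)

lemma cinner_zero_left: "cinner 0 y = 0"
  using cinner_scaleR_left[of 0 0 y] by simp

lemma cinner_add_right: "cinner x (y + z) = cinner x y + cinner x z"
  by (metis cinner_add_left cinner_commute complex_cnj_add)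

lemma cinner_diff_right: "cinner x (y - z) = cinner x y - cinner x z"
  by (metis cinner_diff_left cinner_commute complex_cnj_diff)

lemma cinner_scaleC_right: "cinner x (a *\<^sub>C y) = cnj a * cinner x y"
  by (metis cinner_scaleC_left cinner_commute complex_cnj_mult)

lemma cinner_scaleR_right: "cinner x (r *\<^sub>R y) = complex_of_real r * cinner x y"
  by (metis cinner_scaleC_right scaleC_of_real complex_cnj_complex_of_real)

lemma Re_cinner_commute: "Re (cinner x y) = Re (cinner y x)"
  by (metis cinner_commute cnj.simps(1))

lemma power2_norm_eq_cinner: "(norm x)\<^sup>2 = Re (cinner x x)"
  by (simp add: norm_eq_sqrt_cinner cinner_ge_zero)

lemma power2_norm_add: "(norm (x + y))\<^sup>2 = (norm x)\<^sup>2 + 2 * Re (cinner x y) + (norm y)\<^sup>2"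
  for x y :: "'a::complex_inner"
  by (simp add: power2_norm_eq_cinner cinner_add_left cinner_add_right Re_cinner_commute[of y x])

lemma power2_norm_diff: "(norm (x - y))\<^sup>2 = (norm x)\<^sup>2 - 2 * Re (cinner x y) + (norm y)\<^sup>2"
  for x y :: "'a::complex_inner"
  by (simp add: power2_norm_eq_cinner cinner_diff_left cinner_diff_right Re_cinner_commute[of y x])

lemma parallelogram_law:
  "(norm (x + y))\<^sup>2 + (norm (x - y))\<^sup>2 = 2 * (norm x)\<^sup>2 + 2 * (norm y)\<^sup>2"
  for x y :: "'a::complex_inner"
  by (simp add: power2_norm_add power2_norm_diff)

lemma norm_scaleC: "norm (a *\<^sub>C x) = cmod a * norm x"
proof (rule power2_eq_imp_eq)
  have "cinner (a *\<^sub>C x) (a *\<^sub>C x) = complex_of_real ((cmod a)\<^sup>2) * cinner x x"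
    by (simp only: cinner_scaleC_left cinner_scaleC_right complex_norm_square mult_ac)
  then show "(norm (a *\<^sub>C x))\<^sup>2 = (cmod a * norm x)\<^sup>2"
    by (simp add: power2_norm_eq_cinner power_mult_distrib)
qed auto

text \<open>
  The class postulates the triangle inequality along with the norm, and expanding its square
  yields the Cauchy--Schwarz inequality.
\<close>

lemma Re_cinner_le_norm: "Re (cinner x y) \<le> norm x * norm y"
proof -
  have "(norm (x + y))\<^sup>2 \<le> (norm x + norm y)\<^sup>2"
    by (intro power_mono norm_triangle_ineq) simp
  then show ?thesis
    by (simp add: power2_norm_add power2_sum)
qed

lemma abs_Re_cinner_le_norm: "\<bar>Re (cinner x y)\<bar> \<le> norm x * norm y"
  using Re_cinner_le_norm[of x y] Re_cinner_le_norm[of "- x" y]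
  by (simp add: cinner_minus_left abs_le_iff)

text \<open>
  The constant 2 is not optimal, but suffices to show that the set whose supremum is the
  numerical radius is bounded.
\<close>

lemma cmod_cinner_le: "cmod (cinner x y) \<le> 2 * (norm x * norm y)"
proof -
  have "\<bar>Im (cinner x y)\<bar> = \<bar>Re (cinner (\<i> *\<^sub>C x) y)\<bar>"
    by (simp add: cinner_scaleC_left)
  also have "\<dots> \<le> norm x * norm y"
    using abs_Re_cinner_le_norm[of "\<i> *\<^sub>C x" y] by (simp add: norm_scaleC)
  finally show ?thesis
    using abs_Re_cinner_le_norm[of x y] cmod_le[of "cinner x y"] by linarith
qed

lemma cinner_extensional:
  assumes "\<And>x. cinner x y = cinner x z"
  shows "y = z"
  using assms[of "y - z"] cinner_eq_zero_iff[of "y - z"] by (simp add: cinner_diff_right)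

section \<open>Riesz representation and the adjoint\<close>

text \<open>
  The representing vector is the minimiser of \<open>J z = \<parallel>z\<parallel>\<^sup>2 - 2 f z\<close>. By the parallelogram law
  \<open>J\<close> is so strongly convex that every minimising sequence is Cauchy, and the vanishing of the
  derivative of \<open>J\<close> at the limit is the required identity.
\<close>

lemma riesz_representation_Re:
  fixes f :: "'a::chilbert_space \<Rightarrow> real"
  assumes "bounded_linear f"
  shows "\<exists>z. \<forall>x. f x = Re (cinner x z)"
proof -
  interpret f: bounded_linear f by fact
  define J where "J z = (norm z)\<^sup>2 - 2 * f z" for z
  obtain K where K: "\<And>x. \<bar>f x\<bar> \<le> norm x * K"
    using f.bounded by auto
  have J_ge: "- K\<^sup>2 \<le> J z" for z
  proof -
    have "0 \<le> (norm z - K)\<^sup>2" by simp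
    then show ?thesis
      using K[of z] unfolding J_def power2_diff by linarith
  qed
  define m where "m = (INF z. J z)"
  have bdd: "bdd_below (range J)"
    using J_ge by (auto intro!: bdd_belowI)
  have m_le: "m \<le> J z" for z
    unfolding m_def by (rule cINF_lower[OF bdd]) simp
  have "\<exists>z. J z < m + inverse (real (Suc n))" for n
    using cInf_lessD[of "range J" "m + inverse (real (Suc n))"] by (auto simp: m_def)
  then obtain Z where Z: "\<And>n. J (Z n) < m + inverse (real (Suc n))"
    by metis
  \<comment> \<open>\<open>J\<close> is at least \<open>m\<close> at the midpoint, which keeps near-minimisers close together\<close>
  have J_midpoint: "(norm (z - w))\<^sup>2 \<le> 2 * J z + 2 * J w - 4 * m" for z w
  proof -
    have "4 * J ((1/2) *\<^sub>R (z + w)) = (norm (z + w))\<^sup>2 - 4 * f z - 4 * f w"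
      by (simp add: J_def f.scaleR f.add power_divide add_divide_distrib)
    then have "4 * m \<le> (norm (z + w))\<^sup>2 - 4 * f z - 4 * f w"
      using m_le[of "(1/2) *\<^sub>R (z + w)"] by linarith
    then show ?thesis
      using parallelogram_law[of z w] unfolding J_def right_diff_distrib by linarith
  qed
  have "Cauchy Z"
  proof (rule metric_CauchyI)
    fix e :: real assume "e > 0"
    then have "e\<^sup>2 / 4 > 0" by simp
    then obtain N where N: "inverse (real (Suc N)) < e\<^sup>2 / 4"
      using reals_Archimedean by blast
    show "\<exists>N. \<forall>i\<ge>N. \<forall>j\<ge>N. dist (Z i) (Z j) < e"
    proof (intro exI allI impI)
      fix i j assume "N \<le> i" "N \<le> j"
      then have "inverse (real (Suc i)) \<le> inverse (real (Suc N))"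
          "inverse (real (Suc j)) \<le> inverse (real (Suc N))"
        by (auto intro!: le_imp_inverse_le)
      then have "(norm (Z i - Z j))\<^sup>2 < e\<^sup>2"
        using J_midpoint[of "Z i" "Z j"] Z[of i] Z[of j] N by linarith
      then show "dist (Z i) (Z j) < e"
        using \<open>e > 0\<close> by (simp add: dist_norm power2_less_imp_less)
    qed
  qed
  then obtain l where l: "Z \<longlonglongrightarrow> l"
    using Cauchy_convergent convergent_def by blast
  have "(\<lambda>n. J (Z n)) \<longlonglongrightarrow> J l"
    unfolding J_def by (intro tendsto_intros f.tendsto l)
  moreover have "(\<lambda>n. m + inverse (real (Suc n))) \<longlonglongrightarrow> m + 0"
    by (intro tendsto_intros LIMSEQ_inverse_real_of_nat)
  ultimately have "J l \<le> m + 0"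
    by (rule LIMSEQ_le) (use Z less_imp_le in blast)
  then have J_l: "J l \<le> m" by simp
  have "f v = Re (cinner v l)" for v
  proof -
    define c where "c = Re (cinner v l) - f v"
    define q where "q = (norm v)\<^sup>2"
    have quad: "0 \<le> 2 * t * c + t\<^sup>2 * q" for t
    proof -
      have "J (l + t *\<^sub>R v) = J l + 2 * t * c + t\<^sup>2 * q"
        by (simp add: J_def power2_norm_add f.add f.scaleR cinner_scaleR_right c_def q_def
            Re_cinner_commute[of l v] power_mult_distrib algebra_simps)
      then show ?thesis
        using m_le[of "l + t *\<^sub>R v"] J_l by linarith
    qed
    have q: "q \<ge> 0" by (simp add: q_def)
    \<comment> \<open>the quadratic in \<open>t\<close> is least at \<open>- c / q\<close>; with \<open>q + 1\<close> instead, its value is still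
      negative unless \<open>c = 0\<close>, and \<open>v = 0\<close> causes no division by zero\<close>
    have "2 * (- c / (q + 1)) * c + (- c / (q + 1))\<^sup>2 * q = - (c\<^sup>2 * (q + 2)) / (q + 1)\<^sup>2"
      using q by (simp add: divide_simps) (simp add: algebra_simps power2_eq_square)
    then have "c\<^sup>2 * (q + 2) / (q + 1)\<^sup>2 \<le> 0"
      using quad[of "- c / (q + 1)"] by simp
    then have "c\<^sup>2 * (q + 2) \<le> 0"
      using q by (simp add: divide_le_0_iff)
    then have "c = 0"
      using q by (simp add: mult_le_0_iff)
    then show ?thesis by (simp add: c_def)
  qed
  then show ?thesis by blast
qed

lemma cinner_cadjoint:
  fixes A :: "'a::chilbert_space \<Rightarrow> 'b::complex_inner"
  assumes "bounded_clinear A"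
  shows "cinner (A x) y = cinner x (cadjoint A y)"
proof -
  interpret A: bounded_clinear A by fact
  have "\<exists>z. \<forall>x. cinner (A x) y = cinner x z" for y
  proof -
    obtain K where K: "\<And>x. norm (A x) \<le> norm x * K"
      using A.bounded by auto
    have "bounded_linear (\<lambda>x. Re (cinner (A x) y))"
    proof (rule bounded_linear_intro[where K = "K * norm y"])
      show "norm (Re (cinner (A x) y)) \<le> norm x * (K * norm y)" for x
        using abs_Re_cinner_le_norm[of "A x" y] mult_right_mono[OF K, of "norm y" x]
        by (simp add: mult.assoc)
    qed (simp_all add: A.add A.scaleR cinner_add_left cinner_scaleR_left)
    then obtain z where z: "\<And>x. Re (cinner (A x) y) = Re (cinner x z)"
      using riesz_representation_Re by blast
    \<comment> \<open>the imaginary parts agree because \<open>Im w = - Re (\<i> w)\<close>\<close>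
    have "Im (cinner (A x) y) = Im (cinner x z)" for x
      using z[of "\<i> *\<^sub>C x"] by (simp add: A.scaleC cinner_scaleC_left)
    with z show ?thesis
      by (auto simp: complex_eq_iff)
  qed
  then obtain B where B: "\<And>x y. cinner (A x) y = cinner x (B y)"
    by metis
  have "cadjoint A = B"
    unfolding cadjoint_def
  proof (rule the_equality)
    show "B' = B" if "\<forall>x y. cinner (A x) y = cinner x (B' y)" for B'
      using that B by (metis cinner_extensional ext)
  qed (use B in blast)
  with B show ?thesis by simp
qed

lemma cinner_cadjoint_left:
  fixes A :: "'a::chilbert_space \<Rightarrow> 'b::complex_inner"
  assumes "bounded_clinear A"
  shows "cinner (cadjoint A x) y = cinner x (A y)"
  by (metis assms cinner_cadjoint cinner_commute)

text \<open>
  Boundedness comes from \<open>\<parallel>A\<^sup>* y\<parallel>\<^sup>2 = \<langle>A (A\<^sup>* y), y\<rangle> \<le> K \<parallel>A\<^sup>* y\<parallel> \<parallel>y\<parallel>\<close>, with \<open>K\<close> a bound for \<open>A\<close>.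
\<close>

lemma bounded_linear_cadjoint:
  fixes A :: "'a::chilbert_space \<Rightarrow> 'b::complex_inner"
  assumes "bounded_clinear A"
  shows "bounded_linear (cadjoint A)"
proof -
  interpret A: bounded_clinear A by fact
  note adj = cinner_cadjoint[OF assms, symmetric]
  obtain K where "K > 0" and K: "\<And>x. norm (A x) \<le> norm x * K"
    using A.pos_bounded by auto
  show ?thesis
  proof (rule bounded_linear_intro[where K = K])
    show "cadjoint A (x + y) = cadjoint A x + cadjoint A y" for x y
      by (rule cinner_extensional) (simp add: adj cinner_add_right)
    show "cadjoint A (r *\<^sub>R x) = r *\<^sub>R cadjoint A x" for r x
      by (rule cinner_extensional) (simp add: adj cinner_scaleR_right)
    show "norm (cadjoint A y) \<le> norm y * K" for y
    proof (cases "cadjoint A y = 0")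
      case True
      then show ?thesis using \<open>K > 0\<close> by simp
    next
      case False
      have "(norm (cadjoint A y))\<^sup>2 = Re (cinner (A (cadjoint A y)) y)"
        by (simp add: adj power2_norm_eq_cinner)
      also have "\<dots> \<le> norm (cadjoint A y) * K * norm y"
        using Re_cinner_le_norm mult_right_mono[OF K norm_ge_zero] by (rule order_trans)
      finally show ?thesis
        using False by (simp add: power2_eq_square mult.commute)
    qed
  qed
qed

section \<open>Symmetric operators and their quadratic forms\<close>

text \<open>
  Polarisation expresses \<open>4 Re \<langle>T x, y\<rangle>\<close> as the difference of the quadratic form of \<open>T\<close> at
  \<open>x + y\<close> and \<open>x - y\<close>; taking for \<open>y\<close> the multiple of \<open>T x\<close> of the same length as \<open>x\<close> turns the
  bound on the form into one on \<open>\<parallel>T x\<parallel>\<close>.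
\<close>

lemma onorm_symmetric_le:
  fixes T :: "'a::complex_inner \<Rightarrow> 'a"
  assumes "linear T"
    and sym: "\<And>x y. Re (cinner (T x) y) = Re (cinner x (T y))"
    and form: "\<And>x. \<bar>Re (cinner (T x) x)\<bar> \<le> b * (norm x)\<^sup>2"
    and "b \<ge> 0"
  shows "onorm T \<le> b"
proof (rule onorm_bound)
  interpret T: linear T by fact
  fix x
  show "norm (T x) \<le> b * norm x"
  proof (cases "T x = 0")
    case True
    then show ?thesis using \<open>b \<ge> 0\<close> by simp
  next
    case False
    then have x: "norm x > 0" and Tx: "norm (T x) > 0"
      using T.zero by auto
    define y where "y = (norm x / norm (T x)) *\<^sub>R T x"
    have norm_y: "norm y = norm x"
      using Tx by (simp add: y_def)
    have "Re (cinner (T x) y) = norm x * norm (T x)"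
      using Tx by (simp add: y_def cinner_scaleR_right power2_norm_eq_cinner[symmetric]
          power2_eq_square)
    moreover have "4 * Re (cinner (T x) y)
        = Re (cinner (T (x + y)) (x + y)) - Re (cinner (T (x - y)) (x - y))"
      using sym[of y x] by (simp add: T.add T.diff cinner_add_left cinner_add_right
          cinner_diff_left cinner_diff_right Re_cinner_commute[of y "T x"])
    moreover have "\<dots> \<le> b * ((norm (x + y))\<^sup>2 + (norm (x - y))\<^sup>2)"
      using form[of "x + y"] form[of "x - y"] by (simp add: distrib_left abs_le_iff)
    moreover have "(norm (x + y))\<^sup>2 + (norm (x - y))\<^sup>2 = 4 * (norm x)\<^sup>2"
      by (simp add: parallelogram_law norm_y)
    ultimately have "norm x * norm (T x) \<le> norm x * (b * norm x)"
      by (simp add: power2_eq_square mult.left_commute)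
    then show ?thesis using x by simp
  qed
qed (use assms in simp)

lemma cmod_cinner_le_numerical_radius:
  assumes "bounded_linear A"
  shows "cmod (cinner (A x) x) \<le> numerical_radius A * (norm x)\<^sup>2"
proof (cases "x = 0")
  case True
  then show ?thesis by (simp add: cinner_commute[of _ 0] cinner_zero_left)
next
  case False
  interpret A: bounded_linear A by fact
  obtain K where K: "\<And>x. norm (A x) \<le> norm x * K"
    using A.bounded by auto
  define u where "u = (1 / norm x) *\<^sub>R x"
  have x: "x = norm x *\<^sub>R u" and u: "norm u = 1"
    using False by (simp_all add: u_def)
  have "cmod (cinner (A v) v) \<le> 2 * K" if "norm v = 1" for v
    using cmod_cinner_le[of "A v" v] K[of v] that by simp
  then have "bdd_above ((\<lambda>v. cmod (cinner (A v) v)) ` {v. norm v = 1})"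
    by (auto intro!: bdd_aboveI)
  then have "cmod (cinner (A u) u) \<le> numerical_radius A"
    unfolding numerical_radius_def using u by (intro cSUP_upper) auto
  moreover have "cmod (cinner (A x) x) = (norm x)\<^sup>2 * cmod (cinner (A u) u)"
    by (subst (1 2) x) (simp add: A.scaleR cinner_scaleR_left cinner_scaleR_right norm_mult
        power2_eq_square)
  ultimately show ?thesis
    by (simp add: mult.commute mult_right_mono)
qed

section \<open>The Cartesian decomposition\<close>

lemma cinner_Re_op: "cinner (Re_op A x) y = (cinner (A x) y + cinner (cadjoint A x) y) / 2"
  by (simp add: Re_op_def cinner_scaleC_left cinner_add_left)

lemma cinner_Im_op:
  "cinner (Im_op A x) y = (cinner (A x) y - cinner (cadjoint A x) y) / (2 * \<i>)"
  by (simp add: Im_op_def cinner_scaleC_left cinner_diff_left)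

lemma bounded_linear_scaleC: "bounded_linear (\<lambda>x::'a::complex_inner. a *\<^sub>C x)"
proof (rule bounded_linear_intro[where K = "cmod a"])
  show "a *\<^sub>C r *\<^sub>R x = r *\<^sub>R a *\<^sub>C x" for r and x :: 'a
    by (simp add: scaleC_scaleC mult.commute flip: scaleC_of_real)
qed (simp_all add: scaleC_add_right norm_scaleC)

context
  fixes A :: "'a::chilbert_space \<Rightarrow> 'a"
  assumes A: "bounded_clinear A"
begin

lemma bounded_linear_Re_op: "bounded_linear (Re_op A)"
  unfolding Re_op_def
  by (intro bounded_linear_compose[OF bounded_linear_scaleC] bounded_linear_add
      bounded_linear_cadjoint A bounded_clinear.axioms(1)[OF A])

lemma bounded_linear_Im_op: "bounded_linear (Im_op A)"
  unfolding Im_op_def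
  by (intro bounded_linear_compose[OF bounded_linear_scaleC] bounded_linear_sub
      bounded_linear_cadjoint A bounded_clinear.axioms(1)[OF A])

lemma Re_op_symmetric: "cinner (Re_op A x) y = cinner x (Re_op A y)"
  by (simp add: cinner_Re_op) (simp add: Re_op_def cinner_scaleC_right cinner_add_right
      cinner_cadjoint_left[OF A] cinner_cadjoint[OF A] add.commute)

lemma Im_op_symmetric: "cinner (Im_op A x) y = cinner x (Im_op A y)"
  by (simp add: cinner_Im_op) (simp add: Im_op_def cinner_scaleC_right cinner_diff_right
      cinner_cadjoint_left[OF A] cinner_cadjoint[OF A] right_diff_distrib diff_divide_distrib)

lemma Re_cinner_Re_op: "Re (cinner (Re_op A x) x) = Re (cinner (A x) x)"
  by (simp add: cinner_Re_op cinner_cadjoint_left[OF A] Re_cinner_commute[of x])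

lemma Re_cinner_Im_op: "Re (cinner (Im_op A x) x) = Im (cinner (A x) x)"
  using cinner_commute[of x "A x"]
  by (simp add: cinner_Im_op cinner_cadjoint_left[OF A])

text \<open>
  Both bounds come from \<open>\<bar>Re z\<bar> + \<bar>Im z\<bar> \<le> \<surd>2 \<bar>z\<bar>\<close> at \<open>z = \<langle>A x, x\<rangle>\<close>. The absolute value covers
  the zero space, where the numerical radius is an unspecified real number.
\<close>

lemma onorm_sum_diff_cartesian_le:
  shows "onorm (\<lambda>x. Re_op A x + Im_op A x) \<le> sqrt 2 * \<bar>numerical_radius A\<bar>" (is ?sum)
    and "onorm (\<lambda>x. Re_op A x - Im_op A x) \<le> sqrt 2 * \<bar>numerical_radius A\<bar>" (is ?diff)
proof -
  have parts: "\<bar>Re (cinner (A x) x)\<bar> + \<bar>Im (cinner (A x) x)\<bar>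
      \<le> sqrt 2 * \<bar>numerical_radius A\<bar> * (norm x)\<^sup>2" for x
  proof -
    have "cmod (cinner (A x) x) \<le> \<bar>numerical_radius A\<bar> * (norm x)\<^sup>2"
      using cmod_cinner_le_numerical_radius[OF bounded_clinear.axioms(1)[OF A], of x]
        mult_right_mono[OF abs_ge_self, of "(norm x)\<^sup>2" "numerical_radius A"] by simp
    then have "sqrt 2 * cmod (cinner (A x) x) \<le> sqrt 2 * (\<bar>numerical_radius A\<bar> * (norm x)\<^sup>2)"
      by (rule mult_left_mono) simp
    then show ?thesis
      using complex_abs_le_norm[of "cinner (A x) x"] unfolding mult.assoc by linarith
  qed
  show ?sum
  proof (rule onorm_symmetric_le)
    show "\<bar>Re (cinner (Re_op A x + Im_op A x) x)\<bar>
        \<le> sqrt 2 * \<bar>numerical_radius A\<bar> * (norm x)\<^sup>2" for x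
      using parts[of x] by (simp add: cinner_add_left Re_cinner_Re_op Re_cinner_Im_op)
  qed (auto simp: cinner_add_left cinner_add_right Re_op_symmetric Im_op_symmetric
      intro: bounded_linear.linear bounded_linear_add bounded_linear_Re_op bounded_linear_Im_op)
  show ?diff
  proof (rule onorm_symmetric_le)
    show "\<bar>Re (cinner (Re_op A x - Im_op A x) x)\<bar>
        \<le> sqrt 2 * \<bar>numerical_radius A\<bar> * (norm x)\<^sup>2" for x
      using parts[of x] by (simp add: cinner_diff_left Re_cinner_Re_op Re_cinner_Im_op)
  qed (auto simp: cinner_diff_left cinner_diff_right Re_op_symmetric Im_op_symmetric
      intro: bounded_linear.linear bounded_linear_sub bounded_linear_Re_op bounded_linear_Im_op)
qed

text \<open>
  The parallelogram law for \<open>\<Re>(A) x\<close> and \<open>\<Im>(A) x\<close> removes the mixed terms on the left. The two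
  vectors have the lengths of \<open>1/2 (A x + A\<^sup>* x)\<close> and \<open>1/2 (A x - A\<^sup>* x)\<close>, so the law applies
  once more.
\<close>

lemma norm_sum_diff_cartesian:
  "(norm (Re_op A x + Im_op A x))\<^sup>2 + (norm (Re_op A x - Im_op A x))\<^sup>2
    = (norm (A x))\<^sup>2 + (norm (cadjoint A x))\<^sup>2"
proof -
  have norms: "norm (Re_op A x) = norm (A x + cadjoint A x) / 2"
      "norm (Im_op A x) = norm (A x - cadjoint A x) / 2"
    by (simp_all add: Re_op_def Im_op_def norm_scaleC norm_divide norm_mult)
  have "2 * (norm (Re_op A x))\<^sup>2 + 2 * (norm (Im_op A x))\<^sup>2
      = ((norm (A x + cadjoint A x))\<^sup>2 + (norm (A x - cadjoint A x))\<^sup>2) / 2"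
    by (simp add: norms power_divide)
  also have "\<dots> = (norm (A x))\<^sup>2 + (norm (cadjoint A x))\<^sup>2"
    by (simp only: parallelogram_law) simp
  finally show ?thesis
    by (simp only: parallelogram_law)
qed

text \<open>
  The operator on the left is symmetric with quadratic form \<open>\<parallel>A x\<parallel>\<^sup>2 + \<parallel>A\<^sup>* x\<parallel>\<^sup>2\<close>, which the
  previous identity expresses by the sum and difference of the Cartesian parts.
\<close>

lemma onorm_adjoint_products_le:
  "onorm (\<lambda>x. cadjoint A (A x) + A (cadjoint A x))
    \<le> (onorm (\<lambda>x. Re_op A x + Im_op A x))\<^sup>2 + (onorm (\<lambda>x. Re_op A x - Im_op A x))\<^sup>2"
  (is "_ \<le> ?s\<^sup>2 + ?d\<^sup>2")
proof (rule onorm_symmetric_le)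
  note bl = bounded_linear_cadjoint[OF A] bounded_clinear.axioms(1)[OF A]
  note adj = cinner_cadjoint_left[OF A] cinner_cadjoint[OF A]
  show "linear (\<lambda>x. cadjoint A (A x) + A (cadjoint A x))"
    by (intro bounded_linear.linear bounded_linear_add bounded_linear_compose[OF bl(1) bl(2)]
        bounded_linear_compose[OF bl(2) bl(1)])
  show "Re (cinner (cadjoint A (A x) + A (cadjoint A x)) y)
      = Re (cinner x (cadjoint A (A y) + A (cadjoint A y)))" for x y
    by (simp add: cinner_add_left cinner_add_right adj)
  show "\<bar>Re (cinner (cadjoint A (A x) + A (cadjoint A x)) x)\<bar> \<le> (?s\<^sup>2 + ?d\<^sup>2) * (norm x)\<^sup>2" for x
  proof -
    have "Re (cinner (cadjoint A (A x) + A (cadjoint A x)) x)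
        = (norm (A x))\<^sup>2 + (norm (cadjoint A x))\<^sup>2"
      by (simp only: cinner_add_left adj(1) adj(2)[of "cadjoint A x"] power2_norm_eq_cinner
          plus_complex.sel)
    also have "\<dots> = (norm (Re_op A x + Im_op A x))\<^sup>2 + (norm (Re_op A x - Im_op A x))\<^sup>2"
      by (simp add: norm_sum_diff_cartesian)
    finally have form: "Re (cinner (cadjoint A (A x) + A (cadjoint A x)) x) = \<dots>" .
    have "(norm (Re_op A x + Im_op A x))\<^sup>2 \<le> (?s * norm x)\<^sup>2"
      by (intro power_mono onorm bounded_linear_add bounded_linear_Re_op bounded_linear_Im_op) simp
    moreover have "(norm (Re_op A x - Im_op A x))\<^sup>2 \<le> (?d * norm x)\<^sup>2"
      by (intro power_mono onorm bounded_linear_sub bounded_linear_Re_op bounded_linear_Im_op) simp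
    ultimately show ?thesis
      unfolding form by (simp add: distrib_right power_mult_distrib)
  qed
qed simp

end

theorem theorem2p12:
  fixes A :: "'a::chilbert_space \<Rightarrow> 'a"
  assumes "bounded_clinear A"
  shows "1 / 4 * onorm (\<lambda>x. cadjoint A (A x) + A (cadjoint A x))
      \<le> 1 / 4 * (max ((onorm (\<lambda>x. Re_op A x + Im_op A x))\<^sup>2)
                      ((onorm (\<lambda>x. Re_op A x - Im_op A x))\<^sup>2)
                 + onorm (\<lambda>x. Re_op A x + Im_op A x) * onorm (\<lambda>x. Re_op A x - Im_op A x))
    \<and> 1 / 4 * (max ((onorm (\<lambda>x. Re_op A x + Im_op A x))\<^sup>2)
                    ((onorm (\<lambda>x. Re_op A x - Im_op A x))\<^sup>2)
               + onorm (\<lambda>x. Re_op A x + Im_op A x) * onorm (\<lambda>x. Re_op A x - Im_op A x))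
      \<le> (numerical_radius A)\<^sup>2"
proof -
  define s where "s = onorm (\<lambda>x. Re_op A x + Im_op A x)"
  define d where "d = onorm (\<lambda>x. Re_op A x - Im_op A x)"
  have nonneg: "0 \<le> s" "0 \<le> d"
    unfolding s_def d_def
    by (intro onorm_pos_le bounded_linear_add bounded_linear_sub bounded_linear_Re_op
        bounded_linear_Im_op assms)+
  have first: "s\<^sup>2 + d\<^sup>2 \<le> max (s\<^sup>2) (d\<^sup>2) + s * d"
  proof (cases "s \<le> d")
    case True
    then show ?thesis
      using nonneg mult_left_mono[OF True, of s] power_mono[OF True, of 2]
      by (simp add: power2_eq_square)
  next
    case False
    then show ?thesis
      using nonneg mult_right_mono[of d s d] power_mono[of d s 2]
      by (simp add: power2_eq_square)
  qed
  have le: "s \<le> sqrt 2 * \<bar>numerical_radius A\<bar>" "d \<le> sqrt 2 * \<bar>numerical_radius A\<bar>"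
    unfolding s_def d_def by (rule onorm_sum_diff_cartesian_le[OF assms])+
  have "s\<^sup>2 \<le> 2 * (numerical_radius A)\<^sup>2" "d\<^sup>2 \<le> 2 * (numerical_radius A)\<^sup>2"
    using power_mono[OF le(1), of 2] power_mono[OF le(2), of 2] nonneg
    by (simp_all add: power_mult_distrib)
  moreover have "s * d \<le> (sqrt 2 * \<bar>numerical_radius A\<bar>)\<^sup>2"
    unfolding power2_eq_square by (rule mult_mono[OF le]) (use nonneg in simp_all)
  ultimately have "max (s\<^sup>2) (d\<^sup>2) + s * d \<le> 4 * (numerical_radius A)\<^sup>2"
    by (simp add: power_mult_distrib)
  then show ?thesis
    using first onorm_adjoint_products_le[OF assms] unfolding s_def d_def by simp
qed

end
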